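(* Let $\mathbb{K}$ be a real closed field and $A\in M_n(\overline{\mathbb{K}})\setminus\{0\}$. Let $A=\sum_{i=1}^p\sigma_iA_i$ be the SVD of $A$ constructed as follows: $\lambda_1>\cdots>\lambda_p$ are the distinct strictly positive eigenvalues of $A^*A$, of multiplicities $n_1,\dots,n_p$; $\sigma_i\in\mathbb{K}$ is the strictly positive square root of $\lambda_i$; $\{v_{ij}\ /\ 1\le i\le p,\ 1\le j\le n_i\}$ is an orthonormal set of (column) eigenvectors of $A^*A$ in $\overline{\mathbb{K}}^n$ with $v_{ij}$ associated to $\lambda_i$; and $A_i=\sum_{j=1}^{n_i}\frac{A v_{ij}v_{ij}^*}{\sigma_i}$. Let $A=\sum_{i=1}^q\tau_iB_i$ be any other SVD of $A$. Then $q=p$ and, for every $i$, $\tau_i=\sigma_i$ and $B_i=A_i$.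
   Context: For $\mathbb{K}$ real closed, $\overline{\mathbb{K}}=\mathbb{K}(\sqrt{-1})$ is its algebraic closure, $\mathbb{K}$ has its unique field ordering, and for a matrix or column vector $A$ over $\overline{\mathbb{K}}$, $A^*$ is its transpose conjugate (conjugation $a+b\sqrt{-1}\mapsto a-b\sqrt{-1}$, $a,b\in\mathbb{K}$). Orthonormality in $\overline{\mathbb{K}}^n$ is with respect to the positive definite hermitian product $\langle z,w\rangle=z^*w$. A non-empty family of matrices $A_1,\dots,A_p\in M_n(\overline{\mathbb{K}})\setminus\{0\}$ is an SVD system if $A_i^*A_j=A_iA_j^*=0$ for every $i\ne j$ and $A_iA_i^*A_i=A_i$ for every $i$. A singular value decomposition (SVD) of $A\in M_n(\overline{\mathbb{K}})$ is any decomposition $A=\sum_{i=1}^p\sigma_iA_i$ where $A_1,\dots,A_p\in M_n(\overline{\mathbb{K}})\setminus\{0\}$ form an SVD system and $\sigma_1>\cdots>\sigma_p>0$ are elements of $\mathbb{K}$. (The decomposition constructed in the claim is an SVD of $A$.) *)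

theory Defs
  imports "Jordan_Normal_Form.Schur_Decomposition"
begin

text \<open>
  A real closed field is an ordered field in which every nonnegative element is a square and
  every polynomial of odd degree has a root. The ordering is part of the class, which is
  harmless: on a real closed field it is unique. The polynomial is given by its coefficient
  sequence, as in the library's class \<^class>\<open>alg_closed_field\<close>.
\<close>

class real_closed_field = linordered_field +
  assumes nonneg_is_square: "0 \<le> x \<Longrightarrow> \<exists>y. x = y * y"
    and odd_degree_root: "odd n \<Longrightarrow> c n \<noteq> 0 \<Longrightarrow> \<exists>x. (\<Sum>k\<le>n. c k * x ^ k) = 0"

text \<open>
  The field \<open>K(\<surd>-1)\<close>: \<open>Cplx a b\<close> stands for \<open>a + b\<surd>-1\<close>. Only an ordered field
  \<open>K\<close> is needed for this to be a field.
\<close>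

datatype 'a cplx = Cplx (cRe: 'a) (cIm: 'a)

lemma cplx_eq_iff: "z = w \<longleftrightarrow> cRe z = cRe w \<and> cIm z = cIm w"
  by (cases z; cases w) auto

instantiation cplx :: (linordered_field) field
begin

definition "0 = Cplx 0 0"
definition "1 = Cplx 1 0"
definition "z + w = Cplx (cRe z + cRe w) (cIm z + cIm w)"
definition "z - w = Cplx (cRe z - cRe w) (cIm z - cIm w)"
definition "- z = Cplx (- cRe z) (- cIm z)"
definition "z * w = Cplx (cRe z * cRe w - cIm z * cIm w) (cRe z * cIm w + cIm z * cRe w)"
definition "inverse z = Cplx (cRe z / (cRe z * cRe z + cIm z * cIm z))
                             (- cIm z / (cRe z * cRe z + cIm z * cIm z))"
definition "z div w = z * inverse w" for z w :: "'a cplx"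

instance
proof
  fix z :: "'a cplx"
  assume "z \<noteq> 0"
  then have "cRe z * cRe z + cIm z * cIm z \<noteq> 0"
    by (auto simp: zero_cplx_def cplx_eq_iff)
  then show "inverse z * z = 1"
    by (auto simp: times_cplx_def inverse_cplx_def one_cplx_def cplx_eq_iff
        diff_divide_distrib [symmetric] add_divide_distrib [symmetric])
qed (auto simp: zero_cplx_def one_cplx_def plus_cplx_def minus_cplx_def uminus_cplx_def
      times_cplx_def inverse_cplx_def divide_cplx_def cplx_eq_iff algebra_simps)

end

instantiation cplx :: (linordered_field) conjugatable_field
begin

definition "conjugate z = Cplx (cRe z) (- cIm z)"

instance
  by standard (auto simp: conjugate_cplx_def zero_cplx_def plus_cplx_def uminus_cplx_def
      times_cplx_def cplx_eq_iff)

end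

definition of_base :: "'a :: linordered_field \<Rightarrow> 'a cplx" where
  "of_base x = Cplx x 0"

definition col_mat :: "'a vec \<Rightarrow> 'a mat" where
  "col_mat v = mat_of_cols (dim_vec v) [v]"

text \<open>The hermitian product \<open>z\<^sup>*w\<close>, conjugate-linear in the first argument.\<close>

definition hermitian_prod :: "'a :: conjugatable_field vec \<Rightarrow> 'a vec \<Rightarrow> 'a" where
  "hermitian_prod z w = conjugate z \<bullet> w"

text \<open>
  Matrices do not form an additive monoid as a type, so sums of \<open>n \<times> n\<close> matrices are taken
  in the module \<^const>\<open>module_mat\<close>.
\<close>

abbreviation msum :: "nat \<Rightarrow> ('i \<Rightarrow> 'a :: field mat) \<Rightarrow> 'i set \<Rightarrow> 'a mat" where
  "msum n \<equiv> finsum (module_mat TYPE('a) n n)"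

definition svd_system :: "nat \<Rightarrow> nat \<Rightarrow> (nat \<Rightarrow> 'a :: conjugatable_field mat) \<Rightarrow> bool" where
  "svd_system n p A \<longleftrightarrow>
     1 \<le> p \<and>
     (\<forall>i\<in>{1..p}. A i \<in> carrier_mat n n \<and> A i \<noteq> 0\<^sub>m n n) \<and>
     (\<forall>i\<in>{1..p}. \<forall>j\<in>{1..p}. i \<noteq> j \<longrightarrow>
        mat_adjoint (A i) * A j = 0\<^sub>m n n \<and> A i * mat_adjoint (A j) = 0\<^sub>m n n) \<and>
     (\<forall>i\<in>{1..p}. A i * mat_adjoint (A i) * A i = A i)"

definition is_svd ::
  "nat \<Rightarrow> 'a :: linordered_field cplx mat \<Rightarrow> nat \<Rightarrow> (nat \<Rightarrow> 'a) \<Rightarrow> (nat \<Rightarrow> 'a cplx mat) \<Rightarrow> bool" where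
  "is_svd n M p \<sigma> A \<longleftrightarrow>
     svd_system n p A \<and>
     (\<forall>i\<in>{1..p}. \<forall>j\<in>{1..p}. i < j \<longrightarrow> \<sigma> j < \<sigma> i) \<and>
     (\<forall>i\<in>{1..p}. 0 < \<sigma> i) \<and>
     M = msum n (\<lambda>i. of_base (\<sigma> i) \<cdot>\<^sub>m A i) {1..p}"

end

theory Submission
  imports Defs
begin

text \<open>
  Write \<open>N = M\<^sup>*M\<close>, and let \<open>M = \<Sum> \<tau>\<^sub>j B\<^sub>j\<close> be any singular value decomposition. The products
  \<open>Q\<^sub>j = B\<^sub>j\<^sup>*B\<^sub>j\<close> are mutually orthogonal hermitian projections with \<open>B\<^sub>j Q\<^sub>j = B\<^sub>j\<close>, and
  \<open>M Q\<^sub>j = \<tau>\<^sub>j B\<^sub>j\<close>, so \<open>N Q\<^sub>j = Q\<^sub>j N = \<tau>\<^sub>j\<^sup>2 Q\<^sub>j\<close>. Comparing \<open>Q\<^sub>j N z\<close> computed in two ways shows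
  that \<open>Q\<^sub>j\<close> kills every eigenspace of \<open>N\<close> except that of \<open>\<tau>\<^sub>j\<^sup>2\<close>; and a vector killed by all \<open>Q\<^sub>j\<close>
  is killed by \<open>M\<close>. Hence the positive eigenvalues of \<open>N\<close> are exactly the \<open>\<tau>\<^sub>j\<^sup>2\<close>
  (\<open>positive_eigenvalues\<close>), and \<open>Q\<^sub>j\<close> is the identity on the eigenspace of \<open>\<tau>\<^sub>j\<^sup>2\<close>
  (\<open>Q_fixes_eigenspace\<close>). Both lists of eigenvalues are decreasing, so \<open>q = p\<close> and
  \<open>\<tau>\<^sub>i = \<sigma>\<^sub>i\<close>.

  It remains to see that \<open>Q\<^sub>i\<close> is determined by \<open>M\<close>. Let \<open>V\<close> have the given orthonormal eigenvectors
  for \<open>\<sigma>\<^sub>i\<^sup>2\<close> as columns; then \<open>Q\<^sub>i = V V\<^sup>*\<close> (\<open>Q_eq_orthonormal_eigenbasis\<close>). Indeed the columns of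
  \<open>Q\<^sub>i - V V\<^sup>*\<close> are eigenvectors for the same eigenvalue orthogonal to those of \<open>V\<close>. As \<open>V\<close>
  has as many columns as the eigenvalue has algebraic multiplicity, a nonzero one would
  contradict the inequality between geometric and algebraic multiplicity
  (\<open>eigenspace_exhausted\<close>). Finally
  \<open>A\<^sub>i = \<sigma>\<^sub>i\<inverse> M V V\<^sup>* = \<sigma>\<^sub>i\<inverse> M Q\<^sub>i = B\<^sub>i\<close>.

  The multiplicity inequality (\<open>power_dvd_det\<close>) is obtained without extending eigenvectors to a
  basis: a matrix with \<open>k\<close> independent eigenvectors is factored explicitly, and the determinant of
  one factor is computed from \<open>det (1 - U W) = det (1 - W U)\<close>.
\<close>

section \<open>Geometric multiplicity is at most algebraic multiplicity\<close>

text \<open>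
  The Weinstein--Aronszajn identity: the block matrix with rows \<open>(1, U)\<close> and \<open>(W, 1)\<close> is
  triangularised by clearing its lower left block with row operations or with column operations.
\<close>

lemma det_one_minus_mult_commute:
  fixes U :: "'a :: idom mat"
  assumes U: "U \<in> carrier_mat n k" and W: "W \<in> carrier_mat k n"
  shows "det (1\<^sub>m n - U * W) = det (1\<^sub>m k - W * U)"
proof -
  let ?F = "four_block_mat (1\<^sub>m n) U W (1\<^sub>m k)"
  let ?L = "four_block_mat (1\<^sub>m n) (0\<^sub>m n k) W (1\<^sub>m k)"
  let ?R1 = "four_block_mat (1\<^sub>m n) U (0\<^sub>m k n) (1\<^sub>m k - W * U)"
  let ?R2 = "four_block_mat (1\<^sub>m n - U * W) U (0\<^sub>m k n) (1\<^sub>m k)"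
  have WU: "W * U \<in> carrier_mat k k" and UW: "U * W \<in> carrier_mat n n"
    using U W by auto
  have c: "?L \<in> carrier_mat (n + k) (n + k)" "?R1 \<in> carrier_mat (n + k) (n + k)"
    "?R2 \<in> carrier_mat (n + k) (n + k)"
    using U W by auto
  have e1: "W * U + (1\<^sub>m k - W * U) = 1\<^sub>m k"
    by (rule eq_matI, insert U W, auto)
  have e2: "1\<^sub>m n - U * W + U * W = 1\<^sub>m n"
    by (rule eq_matI, insert U W, auto)
  have "?F = ?L * ?R1"
    by (subst mult_four_block_mat[of _ n n _ k _ k _ _ n _ k], insert U W, auto simp: e1)
  moreover have "?F = ?R2 * ?L"
    by (subst mult_four_block_mat[of _ n n _ k _ k _ _ n _ k], insert U W, auto simp: e2)
  ultimately have "det ?L * det ?R1 = det ?R2 * det ?L"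
    using det_mult[OF c(1,2)] det_mult[OF c(3,1)] by simp
  moreover have "det ?L = 1"
    by (subst det_four_block_mat_upper_right_zero, insert W, auto)
  moreover have "det ?R1 = det (1\<^sub>m k - W * U)"
    by (subst det_four_block_mat_lower_left_zero[of _ n _ k], insert U W, auto)
  moreover have "det ?R2 = det (1\<^sub>m n - U * W)"
    by (subst det_four_block_mat_lower_left_zero[of _ n _ k], insert U W, auto)
  ultimately show ?thesis by simp
qed

text \<open>
  The left inverse \<open>W\<close> expresses that the columns of \<open>U\<close> are independent, in a form that survives
  passage to the polynomial ring. Since \<open>C\<close> acts as \<open>e\<close> on the range of the
  idempotent \<open>P = U W\<close>, it splits as \<open>(C + (1 - e) P) (1 - (1 - e) P)\<close>. The second factor acts
  as \<open>e\<close> on the range of \<open>P\<close> and as \<open>1\<close> on its kernel; the preceding identity turns its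
  determinant into that of the scalar matrix \<open>e\<close> of size \<open>k\<close>.
\<close>

lemma power_dvd_det:
  fixes C :: "'a :: idom mat"
  assumes C: "C \<in> carrier_mat n n" and U: "U \<in> carrier_mat n k" and W: "W \<in> carrier_mat k n"
    and CU: "C * U = e \<cdot>\<^sub>m U" and WU: "W * U = 1\<^sub>m k"
  shows "e ^ k dvd det C"
proof -
  define c where "c = 1 - e"
  define P where "P = U * W"
  have P: "P \<in> carrier_mat n n" using U W by (auto simp: P_def)
  have CP: "C * P = e \<cdot>\<^sub>m P"
    using assoc_mult_mat[OF C U W] CU mult_smult_assoc_mat[OF U W] by (simp add: P_def)
  have "W * P = W"
    using assoc_mult_mat[OF W U W] WU W by (simp add: P_def)
  then have PP: "P * P = P"
    using assoc_mult_mat[OF U W P] by (simp add: P_def)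
  have "(C + c \<cdot>\<^sub>m P) * (1\<^sub>m n - c \<cdot>\<^sub>m P)
      = (C + c \<cdot>\<^sub>m P) - c \<cdot>\<^sub>m (C * P + c \<cdot>\<^sub>m (P * P))"
    using C P 
    by (simp add: mult_minus_distrib_mat[of _ n n _ n] mult_smult_distrib[of _ n n _ n]
        add_mult_distrib_mat[of _ n n] mult_smult_assoc_mat[of _ n n _ n])
  also have "\<dots> = C"
    unfolding CP PP by (rule eq_matI, insert C P, auto simp: c_def algebra_simps)
  finally have "det C = det (C + c \<cdot>\<^sub>m P) * det (1\<^sub>m n - c \<cdot>\<^sub>m P)"
    using det_mult[of "C + c \<cdot>\<^sub>m P" n "1\<^sub>m n - c \<cdot>\<^sub>m P"] C P
    by (simp add: minus_carrier_mat)
  moreover have "det (1\<^sub>m n - c \<cdot>\<^sub>m P) = e ^ k"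
  proof -
    have "c \<cdot>\<^sub>m P = U * (c \<cdot>\<^sub>m W)"
      using mult_smult_distrib[OF U W] by (simp add: P_def)
    then have "det (1\<^sub>m n - c \<cdot>\<^sub>m P) = det (1\<^sub>m k - (c \<cdot>\<^sub>m W) * U)"
      using det_one_minus_mult_commute[OF U, of "c \<cdot>\<^sub>m W"] W by simp
    also have "1\<^sub>m k - (c \<cdot>\<^sub>m W) * U = e \<cdot>\<^sub>m 1\<^sub>m k"
      unfolding mult_smult_assoc_mat[OF W U] WU by (rule eq_matI, auto simp: c_def)
    finally show ?thesis by simp
  qed
  ultimately show ?thesis by simp
qed

text \<open>
  The case of the polynomial matrix \<open>x - A\<close>, which multiplies the columns of \<open>U\<close> by \<open>x - a\<close>.
\<close>

lemma power_dvd_char_poly: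
  fixes A :: "'a :: field mat"
  assumes A: "A \<in> carrier_mat n n" and U: "U \<in> carrier_mat n k" and W: "W \<in> carrier_mat k n"
    and AU: "A * U = a \<cdot>\<^sub>m U" and WU: "W * U = 1\<^sub>m k"
  shows "[:- a, 1:] ^ k dvd char_poly A"
proof -
  interpret h: comm_ring_hom "\<lambda>b :: 'a. [:b:]"
    by unfold_locales (auto simp: one_pCons)
  let ?h = "map_mat (\<lambda>b. [:b:])"
  have "?h (a \<cdot>\<^sub>m U) = [:a:] \<cdot>\<^sub>m ?h U"
    by (rule eq_matI) auto
  then have "?h A * ?h U = [:a:] \<cdot>\<^sub>m ?h U"
    using arg_cong[OF AU, of ?h] by (simp add: h.mat_hom_mult[OF A U])
  moreover have "char_poly_matrix A = [:0, 1:] \<cdot>\<^sub>m 1\<^sub>m n - ?h A"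
    by (rule eq_matI, insert A, auto simp: char_poly_matrix_def)
  ultimately have "char_poly_matrix A * ?h U = [:0, 1:] \<cdot>\<^sub>m ?h U - [:a:] \<cdot>\<^sub>m ?h U"
    using A U
    by (simp add: minus_mult_distrib_mat[of _ n n] mult_smult_assoc_mat[of _ n n _ k])
  also have "\<dots> = [:- a, 1:] \<cdot>\<^sub>m ?h U"
    by (rule eq_matI, auto)
  finally have "char_poly_matrix A * ?h U = [:- a, 1:] \<cdot>\<^sub>m ?h U" .
  moreover have "?h W * ?h U = 1\<^sub>m k"
    using arg_cong[OF WU, of ?h] by (simp add: h.mat_hom_mult[OF W U] h.mat_hom_one)
  ultimately show ?thesis
    unfolding char_poly_def using A U W
    by (intro power_dvd_det[of _ n "?h U" k "?h W"]) auto
qed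

section \<open>Adjoints and the hermitian form\<close>

lemma mat_adjoint_carrier [simp]:
  "A \<in> carrier_mat n k \<Longrightarrow> mat_adjoint A \<in> carrier_mat k n"
  by (auto simp: mat_adjoint_def)

lemma dim_mat_adjoint [simp]:
  "dim_row (mat_adjoint A) = dim_col A" "dim_col (mat_adjoint A) = dim_row A"
  by (auto simp: mat_adjoint_def)

lemma index_mat_adjoint [simp]:
  "i < dim_col A \<Longrightarrow> j < dim_row A \<Longrightarrow> mat_adjoint A $$ (i, j) = conjugate (A $$ (j, i))"
  by (simp add: mat_adjoint_def mat_of_rows_def)

lemma mat_adjoint_adjoint [simp]: "mat_adjoint (mat_adjoint A) = A"
  by (rule eq_matI) auto

lemma mat_adjoint_mult:
  assumes "A \<in> carrier_mat n k" "B \<in> carrier_mat k l"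
  shows "mat_adjoint (A * B) = mat_adjoint B * mat_adjoint A"
  using assms
  by (intro eq_matI)
    (auto simp: scalar_prod_def sum_conjugate conjugate_dist_mul mult.commute intro!: sum.cong)

lemma mat_adjoint_smult: "mat_adjoint (c \<cdot>\<^sub>m A) = conjugate c \<cdot>\<^sub>m mat_adjoint A"
  by (rule eq_matI) (auto simp: conjugate_dist_mul)

lemma mat_adjoint_zero: "mat_adjoint (0\<^sub>m n k) = 0\<^sub>m k n"
  by (rule eq_matI) auto

lemma of_base_simps [simp]:
  "of_base x = of_base y \<longleftrightarrow> x = y" "of_base 0 = 0" "of_base 1 = 1"
  "of_base x * of_base y = of_base (x * y)"  "conjugate (of_base x) = of_base x"
  by (auto simp: of_base_def zero_cplx_def one_cplx_def times_cplx_def conjugate_cplx_def)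

lemma cplx_sum_sel:
  "cRe (sum f S) = (\<Sum>x\<in>S. cRe (f x))" 
  by (induction S rule: infinite_finite_induct) (auto simp: zero_cplx_def plus_cplx_def)

text \<open>
  Definiteness of the hermitian form: the real part of \<open>w\<^sup>*w\<close> is a sum of squares in an ordered
  field.
\<close>

lemma conjugate_scalar_prod_self_eq_0:
  fixes w :: "'a :: linordered_field cplx vec"
  assumes "conjugate w \<bullet> w = 0"
  shows "w = 0\<^sub>v (dim_vec w)"
proof -
  have re: "cRe (conjugate z * z) = cRe z * cRe z + cIm z * cIm z" for z :: "'a cplx"
    by (simp add: conjugate_cplx_def times_cplx_def)
  have "cRe (conjugate w \<bullet> w) = 0" using assms by (simp add: zero_cplx_def)
  then have "(\<Sum>i<dim_vec w. cRe (w $ i) * cRe (w $ i) + cIm (w $ i) * cIm (w $ i)) = 0"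
    by (simp add: scalar_prod_def cplx_sum_sel re lessThan_atLeast0)
  then have "\<forall>i<dim_vec w. cRe (w $ i) * cRe (w $ i) + cIm (w $ i) * cIm (w $ i) = 0"
    by (subst (asm) sum_nonneg_eq_0_iff) auto
  then show ?thesis
    by (intro eq_vecI) (auto simp: cplx_eq_iff zero_cplx_def)
qed

section \<open>Sums of matrices\<close>

lemma msum_empty:
  fixes f :: "'i \<Rightarrow> 'a :: field mat"
  shows "msum n f {} = 0\<^sub>m n n"
proof -
  interpret abelian_group "module_mat TYPE('a) n n" by (rule abelian_group_mat)
  show ?thesis by (simp add: module_mat_simps)
qed

lemma msum_carrier:
  fixes f :: "'i \<Rightarrow> 'a :: field mat"
  assumes "\<And>i. i \<in> S \<Longrightarrow> f i \<in> carrier_mat n n"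
  shows "msum n f S \<in> carrier_mat n n"
proof -
  interpret abelian_group "module_mat TYPE('a) n n" by (rule abelian_group_mat)
  show ?thesis using finsum_closed[of f S] assms by (auto simp: module_mat_simps)
qed

lemma msum_insert:
  fixes f :: "'i \<Rightarrow> 'a :: field mat"
  assumes "finite S" "a \<notin> S" "\<And>i. i \<in> insert a S \<Longrightarrow> f i \<in> carrier_mat n n"
  shows "msum n f (insert a S) = f a + msum n f S"
proof -
  interpret abelian_group "module_mat TYPE('a) n n" by (rule abelian_group_mat)
  show ?thesis using finsum_insert[OF assms(1,2), of f] assms(3) by (auto simp: module_mat_simps)
qed

lemma index_msum:
  fixes f :: "'i \<Rightarrow> 'a :: field mat"
  assumes "finite S" "\<And>i. i \<in> S \<Longrightarrow> f i \<in> carrier_mat n n" "a < n" "b < n"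
  shows "msum n f S $$ (a, b) = (\<Sum>i\<in>S. f i $$ (a, b))"
  using assms
proof (induction S)
  case empty
  then show ?case by (simp add: msum_empty)
next
  case (insert j S)
  then have "msum n f S \<in> carrier_mat n n" by (intro msum_carrier) auto
  then show ?case
    using insert by (subst msum_insert) auto
qed

lemma msum_mult:
  fixes f :: "'i \<Rightarrow> 'a :: field mat"
  assumes "finite S" "\<And>i. i \<in> S \<Longrightarrow> f i \<in> carrier_mat n n" "Z \<in> carrier_mat n k"
    and "\<And>i. i \<in> S \<Longrightarrow> f i * Z = 0\<^sub>m n k"
  shows "msum n f S * Z = 0\<^sub>m n k"
  using assms
proof (induction S)
  case empty
  then show ?case by (simp add: msum_empty)
next
  case (insert j S)
  then have "msum n f S \<in> carrier_mat n n" by (intro msum_carrier) auto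
  then show ?case
    using insert by (subst msum_insert) (auto simp: add_mult_distrib_mat[of _ n n])
qed

lemma mult_msum:
  fixes f :: "'i \<Rightarrow> 'a :: field mat"
  assumes "finite S" "\<And>i. i \<in> S \<Longrightarrow> f i \<in> carrier_mat n n" "Z \<in> carrier_mat k n"
    and "\<And>i. i \<in> S \<Longrightarrow> Z * f i = 0\<^sub>m k n"
  shows "Z * msum n f S = 0\<^sub>m k n"
  using assms
proof (induction S)
  case empty
  then show ?case by (simp add: msum_empty)
next
  case (insert j S)
  then have "msum n f S \<in> carrier_mat n n" by (intro msum_carrier) auto
  then show ?case
    using insert by (subst msum_insert) (auto simp: mult_add_distrib_mat[of Z k n _ n])
qed

text \<open>
  This and its mirror image evaluate products with a singular value decomposition, where
  orthogonality leaves a single summand.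
\<close>

lemma msum_mult_single:
  fixes f :: "'i \<Rightarrow> 'a :: field mat"
  assumes "finite S" "\<And>i. i \<in> S \<Longrightarrow> f i \<in> carrier_mat n n" "Z \<in> carrier_mat n k" "j \<in> S"
    and "\<And>i. i \<in> S \<Longrightarrow> i \<noteq> j \<Longrightarrow> f i * Z = 0\<^sub>m n k"
  shows "msum n f S * Z = f j * Z"
proof -
  have c: "msum n f (S - {j}) \<in> carrier_mat n n" "f j \<in> carrier_mat n n"
    using assms by (auto intro: msum_carrier)
  have "msum n f S = f j + msum n f (S - {j})"
    using msum_insert[of "S - {j}" j f n] assms by (simp add: insert_absorb)
  moreover have "msum n f (S - {j}) * Z = 0\<^sub>m n k"
    using assms by (intro msum_mult) auto
  ultimately show ?thesis
    using assms(3) c by (simp add: add_mult_distrib_mat[of _ n n])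
qed

lemma mult_msum_single:
  fixes f :: "'i \<Rightarrow> 'a :: field mat"
  assumes "finite S" "\<And>i. i \<in> S \<Longrightarrow> f i \<in> carrier_mat n n" "Z \<in> carrier_mat k n" "j \<in> S"
    and "\<And>i. i \<in> S \<Longrightarrow> i \<noteq> j \<Longrightarrow> Z * f i = 0\<^sub>m k n"
  shows "Z * msum n f S = Z * f j"
proof -
  have c: "msum n f (S - {j}) \<in> carrier_mat n n" "f j \<in> carrier_mat n n"
    using assms by (auto intro: msum_carrier)
  have "msum n f S = f j + msum n f (S - {j})"
    using msum_insert[of "S - {j}" j f n] assms by (simp add: insert_absorb)
  moreover have "Z * msum n f (S - {j}) = 0\<^sub>m k n"
    using assms by (intro mult_msum) auto
  ultimately show ?thesis
    using assms(3) c by (simp add: mult_add_distrib_mat[of Z k n _ n])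
qed

section \<open>Matrices whose columns are eigenvectors\<close>

lemma smult_smult_mat:
  fixes X :: "'a :: semigroup_mult mat"
  shows "a \<cdot>\<^sub>m (b \<cdot>\<^sub>m X) = (a * b) \<cdot>\<^sub>m X"
  by (rule eq_matI) (simp_all add: mult.assoc)

lemma smult_minus_mat:
  fixes X :: "'a :: ring mat"
  assumes "X \<in> carrier_mat n k" "Y \<in> carrier_mat n k"
  shows "a \<cdot>\<^sub>m (X - Y) = a \<cdot>\<^sub>m X - a \<cdot>\<^sub>m Y"
  using assms by (intro eq_matI) (auto simp: right_diff_distrib)

lemma minus_mat_eq_0:
  fixes X :: "'a :: group_add mat"
  assumes "X \<in> carrier_mat n k" "Y \<in> carrier_mat n k" "X - Y = 0\<^sub>m n k"
  shows "X = Y"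
proof (rule eq_matI)
  fix i j assume "i < dim_row Y" "j < dim_col Y"
  then show "X $$ (i, j) = Y $$ (i, j)"
    using assms(1,2) arg_cong[OF assms(3), of "\<lambda>Z. Z $$ (i, j)"] by simp
qed (use assms in auto)

text \<open>
  Families of eigenvectors are handled as one matrix \<open>Z\<close> with \<open>N Z = c Z\<close>; this translates
  to single vectors.
\<close>

lemma mult_eq_smult_iff_cols:
  fixes N :: "'a :: comm_ring_1 mat"
  assumes "N \<in> carrier_mat n n" "Z \<in> carrier_mat n k"
  shows "N * Z = c \<cdot>\<^sub>m Z \<longleftrightarrow> (\<forall>j<k. N *\<^sub>v col Z j = c \<cdot>\<^sub>v col Z j)"
proof -
  have cols: "col (N * Z) j = N *\<^sub>v col Z j" "col (c \<cdot>\<^sub>m Z) j = c \<cdot>\<^sub>v col Z j" if "j < k" for j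
    using col_mult2[OF assms that] assms that by (blast, intro eq_vecI, auto)
  have "N * Z = c \<cdot>\<^sub>m Z \<longleftrightarrow> (\<forall>j<k. col (N * Z) j = col (c \<cdot>\<^sub>m Z) j)"
  proof
    assume "\<forall>j<k. col (N * Z) j = col (c \<cdot>\<^sub>m Z) j"
    then show "N * Z = c \<cdot>\<^sub>m Z"
      using assms by (intro mat_col_eqI) (simp_all only: index_mult_mat index_smult_mat carrier_matD)
  qed simp
  then show ?thesis by (simp only: cols cong: imp_cong)
qed

lemma nonzero_mat_has_nonzero_col:
  assumes "Z \<in> carrier_mat n k" "Z \<noteq> 0\<^sub>m n k"
  obtains j where "j < k" "col Z j \<noteq> 0\<^sub>v n"
proof -
  have "\<exists>j<k. col Z j \<noteq> 0\<^sub>v n"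
  proof (rule ccontr)
    assume "\<not> ?thesis"
    then have "Z = 0\<^sub>m n k"
      using assms(1) by (intro mat_col_eqI) auto
    then show False using assms(2) by simp
  qed
  then show ?thesis using that by blast
qed

lemma eigenvalueI:
  fixes N :: "'a :: field mat"
  assumes N: "N \<in> carrier_mat n n" and Z: "Z \<in> carrier_mat n k" "Z \<noteq> 0\<^sub>m n k"
    and NZ: "N * Z = c \<cdot>\<^sub>m Z"
  shows "eigenvalue N c"
proof -
  obtain j where "j < k" "col Z j \<noteq> 0\<^sub>v n"
    using nonzero_mat_has_nonzero_col[OF Z] .
  then have "eigenvector N (col Z j) c"
    using NZ N Z(1) by (auto simp: eigenvector_def mult_eq_smult_iff_cols[OF N Z(1)])
  then show ?thesis by (auto simp: eigenvalue_def)
qed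

text \<open>
  Orthonormal eigenvectors as numerous as the algebraic multiplicity span the whole
  eigenspace: a nonzero column \<open>w\<close> of \<open>Z\<close> could be appended to \<open>V\<close>, giving \<open>m + 1\<close> independent
  eigenvectors, so that the \<open>(m + 1)\<close>-st power of the linear factor would divide the
  characteristic polynomial.
\<close>

lemma eigenspace_exhausted:
  fixes N :: "'a :: linordered_field cplx mat"
  assumes N: "N \<in> carrier_mat n n" and V: "V \<in> carrier_mat n m" and Z: "Z \<in> carrier_mat n k"
    and orth: "mat_adjoint V * V = 1\<^sub>m m" and VZ: "mat_adjoint V * Z = 0\<^sub>m m k"
    and NV: "N * V = c \<cdot>\<^sub>m V" and NZ: "N * Z = c \<cdot>\<^sub>m Z"
    and m: "m = Polynomial.order c (char_poly N)"
  shows "Z = 0\<^sub>m n k"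
proof (rule ccontr)
  assume "Z \<noteq> 0\<^sub>m n k"
  then obtain j where j: "j < k" "col Z j \<noteq> 0\<^sub>v n"
    using nonzero_mat_has_nonzero_col[OF Z] by blast
  define w where "w = col Z j"
  have w: "w \<in> carrier_vec n" using Z by (auto simp: w_def)
  (* The factor s in the dual row makes W * U = 1 hold although w need not be a unit vector. *)
  define s where "s = inverse (conjugate w \<bullet> w)"
  have "conjugate w \<bullet> w \<noteq> 0"
    using conjugate_scalar_prod_self_eq_0[of w] j(2) carrier_vecD[OF w] by (auto simp: w_def [symmetric])
  then have s: "s * (conjugate w \<bullet> w) = 1" by (simp add: s_def)
  define U where "U = mat_of_cols n (cols V @ [w])"
  define W where "W = mat_of_rows n (rows (mat_adjoint V) @ [s \<cdot>\<^sub>v conjugate w])"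
  have U: "U \<in> carrier_mat n (Suc m)" and W: "W \<in> carrier_mat (Suc m) n"
    using V by (auto simp: U_def W_def)
  have colU: "col U b = (if b < m then col V b else w)" if "b < Suc m" for b
    using that V w by (auto simp: U_def nth_append)
  have rowW: "row W a = (if a < m then row (mat_adjoint V) a else s \<cdot>\<^sub>v conjugate w)"
    if "a < Suc m" for a
    using that V w by (auto simp: W_def nth_append)
  have row_adj: "row (mat_adjoint Z) j = conjugate w"
    using Z j(1) by (intro eq_vecI) (auto simp: w_def)
  have ZV: "mat_adjoint Z * V = 0\<^sub>m k m"
    using mat_adjoint_mult[of "mat_adjoint V" m n Z k] VZ V Z by (simp add: mat_adjoint_zero)
  have e1: "row (mat_adjoint V) a \<bullet> col V b = (if a = b then 1 else 0)" if "a < m" "b < m" for a b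
    using arg_cong[OF orth, of "\<lambda>X. X $$ (a, b)"] that V by simp
  have e2: "row (mat_adjoint V) a \<bullet> w = 0" if "a < m" for a
    using arg_cong[OF VZ, of "\<lambda>X. X $$ (a, j)"] that V Z j(1) by (simp add: w_def)
  have e3: "conjugate w \<bullet> col V b = 0" if "b < m" for b
    using arg_cong[OF ZV, of "\<lambda>X. X $$ (j, b)"] that V Z j(1) by (simp add: row_adj)
  have "W * U = 1\<^sub>m (Suc m)"
  proof (rule eq_matI)
    fix a b assume "a < dim_row (1\<^sub>m (Suc m) :: 'a cplx mat)" "b < dim_col (1\<^sub>m (Suc m) :: 'a cplx mat)"
    then have ab: "a < Suc m" "b < Suc m" by auto
    then have "(W * U) $$ (a, b) = row W a \<bullet> col U b" using U W by simp
    then show "(W * U) $$ (a, b) = 1\<^sub>m (Suc m) $$ (a, b)"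
      using ab s w V e1 e2 e3 by (auto simp: colU rowW)
  qed (use U W in auto)
  moreover have "N * U = c \<cdot>\<^sub>m U"
    using NV NZ j(1) by (auto simp: mult_eq_smult_iff_cols[OF N U] colU
        mult_eq_smult_iff_cols[OF N V] mult_eq_smult_iff_cols[OF N Z] w_def)
  ultimately have "[:- c, 1:] ^ Suc m dvd char_poly N"
    using power_dvd_char_poly[OF N U W] by simp
  moreover have "char_poly N \<noteq> 0"
    using degree_monic_char_poly[OF N] by auto
  ultimately show False
    using order_max[of c "Suc m" "char_poly N"] m by simp
qed

section \<open>The projections attached to a singular value decomposition\<close>

locale singular_value_decomposition =
  fixes n q :: nat
    and M :: "'k :: linordered_field cplx mat"
    and \<tau> :: "nat \<Rightarrow> 'k"
    and B :: "nat \<Rightarrow> 'k cplx mat"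
  assumes svd: "is_svd n M q \<tau> B"
begin

text \<open>The orthogonal projection onto the orthogonal complement of the kernel of \<open>B j\<close>.\<close>

definition Q :: "nat \<Rightarrow> 'k cplx mat" where
  "Q j = mat_adjoint (B j) * B j"

lemma tau_pos: "j \<in> {1..q} \<Longrightarrow> 0 < \<tau> j"
  and tau_decreasing: "i \<in> {1..q} \<Longrightarrow> j \<in> {1..q} \<Longrightarrow> i < j \<Longrightarrow> \<tau> j < \<tau> i"
  using svd by (auto simp: is_svd_def)

lemma M_eq: "M = msum n (\<lambda>i. of_base (\<tau> i) \<cdot>\<^sub>m B i) {1..q}"
  using svd by (simp add: is_svd_def)

lemma B_carrier [simp]: "j \<in> {1..q} \<Longrightarrow> B j \<in> carrier_mat n n"
  and B_nonzero: "j \<in> {1..q} \<Longrightarrow> B j \<noteq> 0\<^sub>m n n"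
  using svd by (auto simp: is_svd_def svd_system_def)

lemma B_orthogonal:
  assumes "i \<in> {1..q}" "j \<in> {1..q}" "i \<noteq> j"
  shows "mat_adjoint (B i) * B j = 0\<^sub>m n n" "B i * mat_adjoint (B j) = 0\<^sub>m n n"
  using svd assms by (auto simp: is_svd_def svd_system_def)

lemma B_partial_isometry: "j \<in> {1..q} \<Longrightarrow> B j * mat_adjoint (B j) * B j = B j"
  using svd by (auto simp: is_svd_def svd_system_def)

lemma Q_carrier [simp]: "j \<in> {1..q} \<Longrightarrow> Q j \<in> carrier_mat n n"
  by (simp add: Q_def mult_carrier_mat[of _ n n _ n])

lemma M_carrier [simp]: "M \<in> carrier_mat n n"
  unfolding M_eq by (rule msum_carrier) auto

lemma B_mult_Q: "j \<in> {1..q} \<Longrightarrow> B j * Q j = B j"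
  using B_partial_isometry[of j] assoc_mult_mat[of "B j" n n "mat_adjoint (B j)" n "B j" n]
  by (simp add: Q_def)

lemma Q_nonzero: "j \<in> {1..q} \<Longrightarrow> Q j \<noteq> 0\<^sub>m n n"
  using B_mult_Q[of j] B_nonzero[of j] right_mult_zero_mat[of "B j" n n n] by auto

lemma Q_hermitian: "j \<in> {1..q} \<Longrightarrow> mat_adjoint (Q j) = Q j"
  using mat_adjoint_mult[of "mat_adjoint (B j)" n n "B j" n] by (simp add: Q_def)

lemma Q_mult_Q:
  assumes "i \<in> {1..q}" "j \<in> {1..q}"
  shows "Q i * Q j = (if i = j then Q j else 0\<^sub>m n n)"
proof -
  have "Q i * Q j = mat_adjoint (B i) * (B i * mat_adjoint (B j) * B j)"
    using assms
    by (simp add: Q_def assoc_mult_mat[of _ n n _ n _ n] mult_carrier_mat[of _ n n _ n])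
  then show ?thesis
    using assms B_partial_isometry[of j] B_orthogonal(2)[of i j]
    by (simp add: Q_def left_mult_zero_mat[of "B j" n n] right_mult_zero_mat[of _ n n])
qed

lemma M_mult_Q:
  assumes j: "j \<in> {1..q}"
  shows "M * Q j = of_base (\<tau> j) \<cdot>\<^sub>m B j"
proof -
  have "M * Q j = (of_base (\<tau> j) \<cdot>\<^sub>m B j) * Q j"
    unfolding M_eq
  proof (rule msum_mult_single)
    fix i assume i: "i \<in> {1..q}" "i \<noteq> j"
    have "B i * Q j = B i * mat_adjoint (B j) * B j"
      using i j by (simp add: Q_def assoc_mult_mat[of _ n n _ n _ n])
    also have "\<dots> = 0\<^sub>m n n" using i j B_orthogonal(2)[of i j] left_mult_zero_mat[of "B j" n n n] by simp
    finally show "(of_base (\<tau> i) \<cdot>\<^sub>m B i) * Q j = 0\<^sub>m n n"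
      using i j by (simp add: mult_smult_assoc_mat[of _ n n _ n])
  qed (use j in auto)
  then show ?thesis
    using j B_mult_Q[OF j] by (simp add: mult_smult_assoc_mat[of _ n n _ n])
qed

text \<open>
  Orthogonality isolates the summand in \<open>B\<^sub>j\<^sup>*M\<close>; the claim is the adjoint of that equation, which
  spares taking the adjoint of the sum.
\<close>

lemma adjoint_M_mult_B:
  assumes j: "j \<in> {1..q}"
  shows "mat_adjoint M * B j = of_base (\<tau> j) \<cdot>\<^sub>m Q j"
proof -
  have "mat_adjoint (B j) * M = mat_adjoint (B j) * (of_base (\<tau> j) \<cdot>\<^sub>m B j)"
    unfolding M_eq
  proof (rule mult_msum_single)
    fix i assume i: "i \<in> {1..q}" "i \<noteq> j"
    then show "mat_adjoint (B j) * (of_base (\<tau> i) \<cdot>\<^sub>m B i) = 0\<^sub>m n n"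
      using j B_orthogonal(1)[of j i] by (simp add: mult_smult_distrib[of _ n n _ n])
  qed (use j in auto)
  also have "\<dots> = of_base (\<tau> j) \<cdot>\<^sub>m Q j"
    using j by (simp add: Q_def mult_smult_distrib[of _ n n _ n])
  finally have "mat_adjoint (mat_adjoint (B j) * M) = of_base (\<tau> j) \<cdot>\<^sub>m Q j"
    using Q_hermitian[OF j] by (simp add: mat_adjoint_smult)
  then show ?thesis
    using j by (simp add: mat_adjoint_mult[of _ n n _ n])
qed

lemma gram_carrier [simp]: "mat_adjoint M * M \<in> carrier_mat n n"
  by (simp add: mult_carrier_mat[of _ n n _ n])

lemma gram_mult_Q:
  assumes j: "j \<in> {1..q}"
  shows "mat_adjoint M * M * Q j = of_base ((\<tau> j)\<^sup>2) \<cdot>\<^sub>m Q j"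
proof -
  have "mat_adjoint M * M * Q j = mat_adjoint M * (M * Q j)"
    using j by (simp add: assoc_mult_mat[of _ n n _ n _ n])
  also have "\<dots> = of_base (\<tau> j) \<cdot>\<^sub>m (of_base (\<tau> j) \<cdot>\<^sub>m Q j)"
    using j by (simp add: M_mult_Q mult_smult_distrib[of _ n n _ n] adjoint_M_mult_B)
  also have "\<dots> = of_base ((\<tau> j)\<^sup>2) \<cdot>\<^sub>m Q j"
    by (simp add: smult_smult_mat power2_eq_square)
  finally show ?thesis .
qed

lemma Q_mult_gram:
  assumes j: "j \<in> {1..q}"
  shows "Q j * (mat_adjoint M * M) = of_base ((\<tau> j)\<^sup>2) \<cdot>\<^sub>m Q j"
proof -
  have "mat_adjoint (mat_adjoint M * M * Q j) = of_base ((\<tau> j)\<^sup>2) \<cdot>\<^sub>m Q j"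
    using j by (simp add: gram_mult_Q mat_adjoint_smult Q_hermitian)
  then show ?thesis
    using j by (simp add: mat_adjoint_mult[of _ n n _ n] Q_hermitian)
qed

text \<open>
  Evaluating \<open>Q\<^sub>j M\<^sup>*M Z\<close> from either side gives \<open>\<tau>\<^sub>j\<^sup>2 Q\<^sub>j Z = x Q\<^sub>j Z\<close>.
\<close>

lemma Q_annihilates_other_eigenspaces:
  assumes j: "j \<in> {1..q}" and Z: "Z \<in> carrier_mat n k"
    and NZ: "mat_adjoint M * M * Z = of_base x \<cdot>\<^sub>m Z" and x: "x \<noteq> (\<tau> j)\<^sup>2"
  shows "Q j * Z = 0\<^sub>m n k"
proof -
  have QZ: "Q j * Z \<in> carrier_mat n k" using j Z by (simp add: mult_carrier_mat[of _ n n])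
  have "of_base ((\<tau> j)\<^sup>2) \<cdot>\<^sub>m (Q j * Z) = Q j * (mat_adjoint M * M) * Z"
    using j Z by (simp add: Q_mult_gram mult_smult_assoc_mat[of _ n n _ k])
  also have "\<dots> = Q j * (mat_adjoint M * M * Z)"
    by (rule assoc_mult_mat[OF Q_carrier[OF j] gram_carrier Z])
  also have "\<dots> = of_base x \<cdot>\<^sub>m (Q j * Z)"
    using j Z by (simp add: NZ mult_smult_distrib[of _ n n _ k])
  finally have eq: "of_base ((\<tau> j)\<^sup>2) \<cdot>\<^sub>m (Q j * Z) = of_base x \<cdot>\<^sub>m (Q j * Z)" .
  show ?thesis
  proof (rule eq_matI)
    fix a b assume "a < dim_row (0\<^sub>m n k :: 'k cplx mat)" "b < dim_col (0\<^sub>m n k :: 'k cplx mat)"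
    then have ab: "a < dim_row (Q j * Z)" "b < dim_col (Q j * Z)" "a < n" "b < k"
      using QZ by auto
    have "of_base ((\<tau> j)\<^sup>2) * (Q j * Z) $$ (a, b) = of_base x * (Q j * Z) $$ (a, b)"
      using arg_cong[OF eq, of "\<lambda>X. X $$ (a, b)"] ab(1,2)
      by (simp only: index_smult_mat)
    then have "(Q j * Z) $$ (a, b) = 0" using x by (metis mult_cancel_right of_base_simps(1))
    then show "(Q j * Z) $$ (a, b) = 0\<^sub>m n k $$ (a, b)" using ab by (simp only: index_zero_mat)
  qed (use QZ in auto)
qed

text \<open>
  From \<open>B\<^sub>j = B\<^sub>j Q\<^sub>j\<close>, a vector killed by all \<open>Q\<^sub>j\<close> is killed by all \<open>B\<^sub>j\<close>, hence by \<open>M\<close>;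
  it cannot then be an eigenvector for a nonzero eigenvalue.
\<close>

lemma eigenspace_annihilated_by_all_Q:
  assumes Z: "Z \<in> carrier_mat n k" and NZ: "mat_adjoint M * M * Z = of_base x \<cdot>\<^sub>m Z"
    and x: "x \<noteq> 0" and QZ: "\<And>j. j \<in> {1..q} \<Longrightarrow> Q j * Z = 0\<^sub>m n k"
  shows "Z = 0\<^sub>m n k"
proof -
  have "B j * Z = 0\<^sub>m n k" if j: "j \<in> {1..q}" for j
  proof -
    have "B j * Z = B j * Q j * Z" using j by (simp add: B_mult_Q)
    also have "\<dots> = B j * (Q j * Z)" using j Z by (simp add: assoc_mult_mat[of _ n n _ n _ k])
    finally show ?thesis using j QZ right_mult_zero_mat[OF B_carrier[OF j], of k] by simp
  qed
  then have "M * Z = 0\<^sub>m n k"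
    unfolding M_eq using Z by (intro msum_mult) (auto simp: mult_smult_assoc_mat[of _ n n _ k])
  then have "of_base x \<cdot>\<^sub>m Z = 0\<^sub>m n k"
    using NZ Z assoc_mult_mat[of "mat_adjoint M" n n M n Z k]
      right_mult_zero_mat[of "mat_adjoint M" n n k] by simp
  then have eq: "(of_base x \<cdot>\<^sub>m Z) $$ (a, b) = 0" if "a < n" "b < k" for a b
    using that by simp
  show ?thesis
  proof (rule eq_matI)
    fix a b assume "a < dim_row (0\<^sub>m n k :: 'k cplx mat)" "b < dim_col (0\<^sub>m n k :: 'k cplx mat)"
    then show "Z $$ (a, b) = 0\<^sub>m n k $$ (a, b)"
      using eq[of a b] Z x of_base_simps(1)[of x 0] by simp
  qed (use Z in auto)
qed

text \<open>
  The difference \<open>Z - Q\<^sub>i Z\<close> lies in the same eigenspace. It is killed by \<open>Q\<^sub>i\<close> because \<open>Q\<^sub>i\<close> is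
  idempotent, and by the other \<open>Q\<^sub>j\<close> because they belong to other eigenvalues.
\<close>

lemma Q_fixes_eigenspace:
  assumes i: "i \<in> {1..q}" and Z: "Z \<in> carrier_mat n k"
    and NZ: "mat_adjoint M * M * Z = of_base ((\<tau> i)\<^sup>2) \<cdot>\<^sub>m Z"
  shows "Q i * Z = Z"
proof -
  have QZ: "Q i * Z \<in> carrier_mat n k" using i Z by (simp add: mult_carrier_mat[of _ n n])
  have "Z - Q i * Z = 0\<^sub>m n k"
  proof (rule eigenspace_annihilated_by_all_Q[where x = "(\<tau> i)\<^sup>2"])
    have "mat_adjoint M * M * (Q i * Z) = mat_adjoint M * M * Q i * Z"
      by (rule assoc_mult_mat[OF gram_carrier Q_carrier[OF i] Z, symmetric])
    also have "\<dots> = of_base ((\<tau> i)\<^sup>2) \<cdot>\<^sub>m (Q i * Z)"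
      using i Z by (simp add: gram_mult_Q mult_smult_assoc_mat[of _ n n _ k])
    finally show "mat_adjoint M * M * (Z - Q i * Z) = of_base ((\<tau> i)\<^sup>2) \<cdot>\<^sub>m (Z - Q i * Z)"
      by (simp only: mult_minus_distrib_mat[OF gram_carrier Z QZ] NZ smult_minus_mat[OF Z QZ])
  next
    fix j assume j: "j \<in> {1..q}"
    have "Q j * (Z - Q i * Z) = Q j * Z - Q j * (Q i * Z)"
      using j Z QZ by (simp add: mult_minus_distrib_mat[of _ n n _ k])
    also have "Q j * (Q i * Z) = Q j * Q i * Z"
      by (rule assoc_mult_mat[OF Q_carrier[OF j] Q_carrier[OF i] Z, symmetric])
    also have "Q j * Z - Q j * Q i * Z = 0\<^sub>m n k"
    proof (cases "j = i")
      case True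
      then show ?thesis using QZ i by (simp add: Q_mult_Q)
    next
      case False
      then have "\<tau> i \<noteq> \<tau> j"
        using tau_decreasing[OF i j] tau_decreasing[OF j i]
        by (cases i j rule: linorder_cases) auto
      then have "(\<tau> i)\<^sup>2 \<noteq> (\<tau> j)\<^sup>2"
        using power2_eq_imp_eq[of "\<tau> i" "\<tau> j"] tau_pos[OF i] tau_pos[OF j] by auto
      then have "Q j * Z = 0\<^sub>m n k" using Q_annihilates_other_eigenspaces[OF j Z NZ] by simp
      then show ?thesis using False i j Z by (simp add: Q_mult_Q)
    qed
    finally show "Q j * (Z - Q i * Z) = 0\<^sub>m n k" .
  next
    show "Z - Q i * Z \<in> carrier_mat n k" by (rule minus_carrier_mat[OF QZ])
    show "(\<tau> i)\<^sup>2 \<noteq> 0" using tau_pos[OF i] by simp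
  qed
  then show ?thesis by (rule minus_mat_eq_0[OF Z QZ, symmetric])
qed

lemma positive_eigenvalues:
  "{x. 0 < x \<and> eigenvalue (mat_adjoint M * M) (of_base x)} = (\<lambda>j. (\<tau> j)\<^sup>2) ` {1..q}"
proof (intro equalityI subsetI)
  fix x assume "x \<in> {x. 0 < x \<and> eigenvalue (mat_adjoint M * M) (of_base x)}"
  then obtain w where x: "0 < x" and ev: "eigenvector (mat_adjoint M * M) w (of_base x)"
    by (auto simp: eigenvalue_def)
  from ev have w: "w \<in> carrier_vec n" "w \<noteq> 0\<^sub>v n"
    and Nw: "mat_adjoint M * M *\<^sub>v w = of_base x \<cdot>\<^sub>v w"
    using carrier_matD(2)[OF M_carrier] by (auto simp: eigenvector_def)
  define Z where "Z = mat_of_cols n [w]"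
  have Z: "Z \<in> carrier_mat n 1" by (auto simp: Z_def)
  have col: "col Z 0 = w" using w by (simp add: Z_def)
  have NZ: "mat_adjoint M * M * Z = of_base x \<cdot>\<^sub>m Z"
    using Nw col by (simp add: mult_eq_smult_iff_cols[OF gram_carrier Z])
  have "Z \<noteq> 0\<^sub>m n 1" using w col by auto
  show "x \<in> (\<lambda>j. (\<tau> j)\<^sup>2) ` {1..q}"
  proof (rule ccontr)
    assume "\<not> ?thesis"
    then have "Q j * Z = 0\<^sub>m n 1" if "j \<in> {1..q}" for j
      using Q_annihilates_other_eigenspaces[OF that Z NZ] that by blast
    then show False
      using eigenspace_annihilated_by_all_Q[OF Z NZ] x \<open>Z \<noteq> 0\<^sub>m n 1\<close> by simp
  qed
next
  fix x assume "x \<in> (\<lambda>j. (\<tau> j)\<^sup>2) ` {1..q}"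
  then obtain j where j: "j \<in> {1..q}" and x: "x = (\<tau> j)\<^sup>2" by auto
  have "eigenvalue (mat_adjoint M * M) (of_base x)"
    unfolding x by (rule eigenvalueI[OF gram_carrier Q_carrier Q_nonzero gram_mult_Q]) (fact j)+
  then show "x \<in> {x. 0 < x \<and> eigenvalue (mat_adjoint M * M) (of_base x)}"
    using tau_pos[OF j] x by simp
qed

text \<open>
  This makes \<open>Q\<^sub>i\<close> depend on \<open>M\<close> alone. The columns of \<open>Q\<^sub>i - V V\<^sup>*\<close> lie in the eigenspace
  and are orthogonal to \<open>V\<close>, since \<open>V\<^sup>*Q\<^sub>i = (Q\<^sub>i V)\<^sup>* = V\<^sup>*\<close>; as \<open>V\<close> already exhausts the
  eigenspace, they vanish.
\<close>

lemma Q_eq_orthonormal_eigenbasis: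
  assumes i: "i \<in> {1..q}" and V: "V \<in> carrier_mat n m"
    and orth: "mat_adjoint V * V = 1\<^sub>m m"
    and NV: "mat_adjoint M * M * V = of_base ((\<tau> i)\<^sup>2) \<cdot>\<^sub>m V"
    and m: "m = Polynomial.order (of_base ((\<tau> i)\<^sup>2)) (char_poly (mat_adjoint M * M))"
  shows "V * mat_adjoint V = Q i"
proof -
  let ?N = "mat_adjoint M * M" and ?P = "V * mat_adjoint V"
  have V': "mat_adjoint V \<in> carrier_mat m n" using V by simp
  have P: "?P \<in> carrier_mat n n" using V by (auto intro: mult_carrier_mat)
  have "Q i - ?P = 0\<^sub>m n n"
  proof (rule eigenspace_exhausted[OF gram_carrier V _ orth _ NV _ m])
    have "?N * ?P = ?N * V * mat_adjoint V"
      using assoc_mult_mat[OF gram_carrier V V'] by simp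
    also have "\<dots> = of_base ((\<tau> i)\<^sup>2) \<cdot>\<^sub>m ?P"
      using V by (simp add: NV mult_smult_assoc_mat[of _ n m _ n])
    finally show "?N * (Q i - ?P) = of_base ((\<tau> i)\<^sup>2) \<cdot>\<^sub>m (Q i - ?P)"
      by (simp only: mult_minus_distrib_mat[OF gram_carrier Q_carrier[OF i] P] gram_mult_Q[OF i]
          smult_minus_mat[OF Q_carrier[OF i] P])
  next
    have "mat_adjoint V * Q i = mat_adjoint (Q i * V)"
      using i V by (simp add: mat_adjoint_mult[of _ n n _ m] Q_hermitian)
    also have "\<dots> = mat_adjoint V"
      using Q_fixes_eigenspace[OF i V NV] by simp
    finally have "mat_adjoint V * Q i = mat_adjoint V" .
    moreover have "mat_adjoint V * ?P = mat_adjoint V"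
      using V V' orth assoc_mult_mat[of "mat_adjoint V" m n V m "mat_adjoint V" n] by simp
    ultimately show "mat_adjoint V * (Q i - ?P) = 0\<^sub>m m n"
      using mult_minus_distrib_mat[OF V' Q_carrier[OF i] P] V' by simp
  next
    show "Q i - ?P \<in> carrier_mat n n" by (rule minus_carrier_mat[OF P])
  qed
  then show ?thesis by (rule minus_mat_eq_0[OF Q_carrier[OF i] P, symmetric])
qed

end

section \<open>Uniqueness\<close>

lemma decreasing_enumeration_unique:
  fixes f g :: "nat \<Rightarrow> 'a :: linorder"
  assumes f: "\<And>i j. i \<in> {1..p} \<Longrightarrow> j \<in> {1..p} \<Longrightarrow> i < j \<Longrightarrow> f j < f i"
    and g: "\<And>i j. i \<in> {1..q} \<Longrightarrow> j \<in> {1..q} \<Longrightarrow> i < j \<Longrightarrow> g j < g i"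
    and eq: "f ` {1..p} = g ` {1..q}"
  shows "p = q \<and> (\<forall>i\<in>{1..p}. f i = g i)"
proof -
  have dec: "sorted_wrt (<) (rev (map h [1..<Suc r]))"
    if "\<And>i j. i \<in> {1..r} \<Longrightarrow> j \<in> {1..r} \<Longrightarrow> i < j \<Longrightarrow> h j < h i"
    for h :: "nat \<Rightarrow> 'a" and r
  proof -
    have "sorted_wrt (\<lambda>i j. h j < h i) [1..<Suc r]"
      unfolding sorted_wrt_iff_nth_less using that by (auto simp del: upt_Suc)
    then show ?thesis by (simp add: sorted_wrt_rev sorted_wrt_map del: upt_Suc)
  qed
  have "rev (map f [1..<Suc p]) = rev (map g [1..<Suc q])"
    using dec[OF f] dec[OF g] eq
    by (intro strict_sorted_equal) (auto simp: atLeastLessThanSuc_atLeastAtMost simp del: upt_Suc)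
  then have l: "map f [1..<Suc p] = map g [1..<Suc q]" by simp
  then have "length (map f [1..<Suc p]) = length (map g [1..<Suc q])" by (rule arg_cong)
  then have pq: "p = q" by (simp only: length_map length_upt diff_Suc_1)
  have "f i = g i" if "i \<in> {1..p}" for i
  proof -
    obtain k where "i = Suc k" "k < p"
    proof (cases i)
      case (Suc k)
      then show ?thesis using that(1) \<open>i \<in> {1..p}\<close> by simp
    qed (use \<open>i \<in> {1..p}\<close> in simp)
    then show ?thesis
      using arg_cong[OF l, of "\<lambda>xs. xs ! k"] pq by (simp del: upt_Suc)
  qed
  with pq show ?thesis by simp
qed

text \<open>
  Rewrites the defining sum of \<open>A\<^sub>i\<close> in terms of the matrix \<open>V\<close> of eigenvectors, using
  \<open>V V\<^sup>* = \<Sum> v\<^sub>j v\<^sub>j\<^sup>*\<close>. Column \<open>k\<close> of \<open>V\<close>, counted from \<open>0\<close>, is the vector with index \<open>Suc k\<close>.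
\<close>

lemma msum_rank_one_eq:
  fixes M :: "'a :: conjugatable_field mat"
  assumes M: "M \<in> carrier_mat n n" and u: "\<And>j. j \<in> {1..m} \<Longrightarrow> u j \<in> carrier_vec n"
  defines "V \<equiv> mat_of_cols n (map u [1..<Suc m])"
  shows "msum n (\<lambda>j. c \<cdot>\<^sub>m (M * col_mat (u j) * mat_adjoint (col_mat (u j)))) {1..m}
    = c \<cdot>\<^sub>m (M * (V * mat_adjoint V))" (is "msum n ?f _ = _")
proof -
  have V: "V \<in> carrier_mat n m" by (auto simp: V_def simp del: upt_Suc intro!: carrier_matI)
  have Vi: "V $$ (b, k) = u (Suc k) $ b" if "b < n" "k < m" for b k
    using that by (simp add: V_def mat_of_cols_index del: upt_Suc)
  have colV: "col V k = u (Suc k)" if "k < m" for k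
    using that V Vi u[of "Suc k"] by (intro eq_vecI) auto
  have cm: "col_mat (u j) \<in> carrier_mat n 1" if "j \<in> {1..m}" for j
    using u[OF that] by (auto simp: col_mat_def)
  have col_cm: "col (col_mat (u j)) 0 = u j" for j
    by (simp add: col_mat_def)
  have f: "?f j \<in> carrier_mat n n" if "j \<in> {1..m}" for j
    using mult_carrier_mat[OF mult_carrier_mat[OF M cm[OF that]]
        mat_adjoint_carrier[OF cm[OF that]]] by simp
  have entry: "?f (Suc k) $$ (a, b) = c * ((row M a \<bullet> col V k) * conjugate (V $$ (b, k)))"
    if "a < n" "b < n" "k < m" for a b k
  proof -
    have j: "Suc k \<in> {1..m}" using that by simp
    let ?C = "col_mat (u (Suc k))"
    have "(M * ?C * mat_adjoint ?C) $$ (a, b) = (M * ?C) $$ (a, 0) * mat_adjoint ?C $$ (0, b)"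
      using M cm[OF j] that by (simp add: scalar_prod_def)
    moreover have "mat_adjoint ?C $$ (0, b) = conjugate (u (Suc k) $ b)"
      using cm[OF j] that arg_cong[OF col_cm[of "Suc k"], of "\<lambda>x. x $ b"] by simp
    moreover have "(M * ?C) $$ (a, 0) = row M a \<bullet> col V k"
      using M cm[OF j] that by (simp add: col_cm colV)
    moreover have "?f (Suc k) $$ (a, b) = c * (M * ?C * mat_adjoint ?C) $$ (a, b)"
      using M cm[OF j] that by simp
    ultimately show ?thesis using that by (simp add: Vi)
  qed
  have "msum n ?f {1..m} = c \<cdot>\<^sub>m (M * V * mat_adjoint V)"
  proof (rule eq_matI)
    fix a b
    assume "a < dim_row (c \<cdot>\<^sub>m (M * V * mat_adjoint V))" "b < dim_col (c \<cdot>\<^sub>m (M * V * mat_adjoint V))"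
    then have ab: "a < n" "b < n" using M V by auto
    have "msum n ?f {1..m} $$ (a, b) = (\<Sum>j\<in>{1..m}. ?f j $$ (a, b))"
      using f ab by (intro index_msum) auto
    also have "\<dots> = (\<Sum>k<m. ?f (Suc k) $$ (a, b))"
      using sum.atLeast1_atMost_eq[of "\<lambda>j. ?f j $$ (a, b)" m] by simp
    also have "\<dots> = (\<Sum>k<m. c * ((row M a \<bullet> col V k) * conjugate (V $$ (b, k))))"
      using entry ab by (intro sum.cong) auto
    also have "\<dots> = (c \<cdot>\<^sub>m (M * V * mat_adjoint V)) $$ (a, b)"
      using M V ab
      by (simp add: scalar_prod_def[of _ "col (mat_adjoint V) b"] sum_distrib_left lessThan_atLeast0)
    finally show "msum n ?f {1..m} $$ (a, b) = (c \<cdot>\<^sub>m (M * V * mat_adjoint V)) $$ (a, b)" .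
  qed (use msum_carrier[of "{1..m}" ?f n] f M V in auto)
  then show ?thesis
    using assoc_mult_mat[OF M V, of "mat_adjoint V" n] V by simp
qed

theorem proposition4p10:
  fixes n p q :: nat
    and M :: "'k :: real_closed_field cplx mat"
    and \<mu> \<sigma> \<tau> :: "nat \<Rightarrow> 'k"
    and m :: "nat \<Rightarrow> nat"
    and v :: "nat \<Rightarrow> nat \<Rightarrow> 'k cplx vec"
    and A B :: "nat \<Rightarrow> 'k cplx mat"
  assumes M: "M \<in> carrier_mat n n" "M \<noteq> 0\<^sub>m n n"
    and eigenvalues_decreasing: "\<forall>i\<in>{1..p}. \<forall>j\<in>{1..p}. i < j \<longrightarrow> \<mu> j < \<mu> i"
    and eigenvalues: "\<mu> ` {1..p} = {x. 0 < x \<and> eigenvalue (mat_adjoint M * M) (of_base x)}"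
    and multiplicities:
      "\<forall>i\<in>{1..p}. m i = Polynomial.order (of_base (\<mu> i)) (char_poly (mat_adjoint M * M))"
    and square_roots: "\<forall>i\<in>{1..p}. 0 < \<sigma> i \<and> (\<sigma> i)\<^sup>2 = \<mu> i"
    and eigenvectors:
      "\<forall>i\<in>{1..p}. \<forall>j\<in>{1..m i}. eigenvector (mat_adjoint M * M) (v i j) (of_base (\<mu> i))"
    and orthonormal:
      "\<forall>i\<in>{1..p}. \<forall>j\<in>{1..m i}. \<forall>k\<in>{1..p}. \<forall>l\<in>{1..m k}.
         hermitian_prod (v i j) (v k l) = (if i = k \<and> j = l then 1 else 0)"
    and A: "\<forall>i\<in>{1..p}. A i =
      msum n (\<lambda>j. of_base (1 / \<sigma> i) \<cdot>\<^sub>m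
                (M * col_mat (v i j) * mat_adjoint (col_mat (v i j)))) {1..m i}"
    and other_svd: "is_svd n M q \<tau> B"
  shows "q = p \<and> (\<forall>i\<in>{1..p}. \<tau> i = \<sigma> i \<and> B i = A i)"
proof -
  interpret singular_value_decomposition n q M \<tau> B
    by unfold_locales (fact other_svd)
  have "p = q \<and> (\<forall>i\<in>{1..p}. \<mu> i = (\<tau> i)\<^sup>2)"
  proof (rule decreasing_enumeration_unique)
    show "\<mu> ` {1..p} = (\<lambda>j. (\<tau> j)\<^sup>2) ` {1..q}"
      unfolding eigenvalues by (rule positive_eigenvalues)
    show "(\<tau> j)\<^sup>2 < (\<tau> i)\<^sup>2" if "i \<in> {1..q}" "j \<in> {1..q}" "i < j" for i j
      using tau_decreasing[OF that] tau_pos[OF that(2)] by (intro power_strict_mono) auto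
  qed (use eigenvalues_decreasing in auto)
  then have pq: "p = q" and \<mu>: "\<And>i. i \<in> {1..p} \<Longrightarrow> \<mu> i = (\<tau> i)\<^sup>2" by auto
  have "\<tau> i = \<sigma> i \<and> B i = A i" if i: "i \<in> {1..p}" for i
  proof
    have iq: "i \<in> {1..q}" using i pq by simp
    have \<sigma>: "0 < \<sigma> i" "(\<sigma> i)\<^sup>2 = \<mu> i" using square_roots i by auto
    show \<tau>\<sigma>: "\<tau> i = \<sigma> i"
      using \<sigma> \<mu>[OF i] tau_pos[OF iq] by (intro power2_eq_imp_eq [of "\<tau> i" "\<sigma> i"]) auto
    define V where "V = mat_of_cols n (map (v i) [1..<Suc (m i)])"
    have V: "V \<in> carrier_mat n (m i)"
      by (auto simp: V_def simp del: upt_Suc intro!: carrier_matI)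
    have ev: "v i j \<in> carrier_vec n"
      "mat_adjoint M * M *\<^sub>v v i j = of_base ((\<tau> i)\<^sup>2) \<cdot>\<^sub>v v i j" if "j \<in> {1..m i}" for j
      using eigenvectors i that M(1) \<mu>[OF i] by (auto simp: eigenvector_def)
    have colV: "col V k = v i (Suc k)" if "k < m i" for k
      using that ev(1)[of "Suc k"] by (simp add: V_def del: upt_Suc)
    have "V * mat_adjoint V = Q i"
    proof (rule Q_eq_orthonormal_eigenbasis[OF iq V])
      show "mat_adjoint V * V = 1\<^sub>m (m i)"
      proof (rule eq_matI)
        fix a b
        assume "a < dim_row (1\<^sub>m (m i) :: 'k cplx mat)" "b < dim_col (1\<^sub>m (m i) :: 'k cplx mat)"
        then have ab: "a < m i" "b < m i" by auto
        have "row (mat_adjoint V) a = conjugate (v i (Suc a))"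
          unfolding colV[OF ab(1), symmetric] using V ab by (intro eq_vecI) auto
        then have "(mat_adjoint V * V) $$ (a, b) = hermitian_prod (v i (Suc a)) (v i (Suc b))"
          using V ab by (simp add: hermitian_prod_def colV)
        also have "\<dots> = (if a = b then 1 else 0)" using orthonormal i ab by simp
        finally show "(mat_adjoint V * V) $$ (a, b) = 1\<^sub>m (m i) $$ (a, b)" using ab by simp
      qed (use V in auto)
      show "mat_adjoint M * M * V = of_base ((\<tau> i)\<^sup>2) \<cdot>\<^sub>m V"
        using ev(2) by (simp add: mult_eq_smult_iff_cols[OF gram_carrier V] colV)
      show "m i = Polynomial.order (of_base ((\<tau> i)\<^sup>2)) (char_poly (mat_adjoint M * M))"
        using multiplicities i \<mu>[OF i] by simp
    qed
    moreover have "A i = of_base (1 / \<sigma> i) \<cdot>\<^sub>m (M * (V * mat_adjoint V))"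
      unfolding V_def bspec[OF A i] by (rule msum_rank_one_eq[OF M(1) ev(1)])
    ultimately have "A i = of_base (1 / \<sigma> i) \<cdot>\<^sub>m (of_base (\<sigma> i) \<cdot>\<^sub>m B i)"
      using M_mult_Q[OF iq] \<tau>\<sigma> by simp
    also have "\<dots> = (of_base (1 / \<sigma> i) * of_base (\<sigma> i)) \<cdot>\<^sub>m B i"
      by (rule smult_smult_mat)
    also have "of_base (1 / \<sigma> i) * of_base (\<sigma> i) = (1 :: 'k cplx)"
      using \<sigma>(1) by simp
    also have "1 \<cdot>\<^sub>m B i = B i" by (rule eq_matI) simp_all
    finally show "B i = A i" ..
  qed
  with pq show ?thesis by simp
qed

end
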